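(* Let $\mathcal{A}\in\mathbb{C}^{I_{1}\times\cdots\times I_{M}\times J_{1}\times\cdots\times J_{N}}$ and $\mathcal{B}\in\mathbb{C}^{J_{1}\times\cdots\times J_{N}\times K_{1}\times\cdots\times K_{L}}$. Then $(\mathcal{A}*_N\mathcal{B})^{\dagger}=\mathcal{B}^{\dagger}*_N\mathcal{A}^{\dagger}$ if and only if both of the following conditions hold: (i) $\mathcal{A}^{\dagger}*_M\mathcal{A}*_N\mathcal{B}*_L\mathcal{B}^{H}*_N\mathcal{A}^{H}=\mathcal{B}*_L\mathcal{B}^{H}*_N\mathcal{A}^{H}$; (ii) $\mathcal{A}*_N\mathcal{B}*_L\mathcal{B}^{\dagger}*_N\mathcal{A}^{\dagger}$ is Hermitian.
   Context: Einstein product: for $\mathcal{A}\in\mathbb{C}^{I_1\times\cdots\times I_M\times J_1\times\cdots\times J_N}$ and $\mathcal{B}\in\mathbb{C}^{J_1\times\cdots\times J_N\times K_1\times\cdots\times K_L}$, $(\mathcal{A}*_N\mathcal{B})_{i_1\cdots i_Mk_1\cdots k_L}=\sum_{j_1,\dots,j_N}a_{i_1\cdots i_Mj_1\cdots j_N}b_{j_1\cdots j_Nk_1\cdots k_L}$; the subscript indicates the number of contracted modes ($*_M$, $*_L$ are analogous). Conjugate transpose: $(\mathcal{A}^H)_{j_1\cdots j_Ni_1\cdots i_M}=\overline{a_{i_1\cdots i_Mj_1\cdots j_N}}$; a tensor $\mathcal{C}\in\mathbb{C}^{I_1\times\cdots\times I_M\times I_1\times\cdots\times I_M}$ is Hermitian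 if $\mathcal{C}^H=\mathcal{C}$. Moore--Penrose inverse: for $\mathcal{X}\in\mathbb{C}^{I_1\times\cdots\times I_M\times J_1\times\cdots\times J_N}$, $\mathcal{X}^\dagger$ is the unique $\mathcal{Y}\in\mathbb{C}^{J_1\times\cdots\times J_N\times I_1\times\cdots\times I_M}$ with (1) $\mathcal{X}*_N\mathcal{Y}*_M\mathcal{X}=\mathcal{X}$, (2) $\mathcal{Y}*_M\mathcal{X}*_N\mathcal{Y}=\mathcal{Y}$, (3) $(\mathcal{X}*_N\mathcal{Y})^H=\mathcal{X}*_N\mathcal{Y}$, (4) $(\mathcal{Y}*_M\mathcal{X})^H=\mathcal{Y}*_M\mathcal{X}$. *)

theory Defs
  imports Complex_Main
begin

(* A mode of dimension d is indexed by 0, ..., d - 1. *)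
definition multi_indices :: "nat list \<Rightarrow> nat list set" where
  "multi_indices ds = {is. list_all2 (<) is ds}"

(* The elements of C^(d_1 x ... x d_p) for all shapes [d_1, ..., d_p] together.  Entries are
   normalised to 0 outside the index range, so equality of tensors is equality of the shapes
   and of all entries. *)
typedef ctensor =
  "{T :: nat list \<times> (nat list \<Rightarrow> complex). \<forall>is. is \<notin> multi_indices (fst T) \<longrightarrow> snd T is = 0}"
  by (rule exI[of _ "([], \<lambda>_. 0)"]) simp

definition dims :: "ctensor \<Rightarrow> nat list" where
  "dims A = fst (Rep_ctensor A)"

definition entry :: "ctensor \<Rightarrow> nat list \<Rightarrow> complex" where
  "entry A = snd (Rep_ctensor A)"

definition mk_tensor :: "nat list \<Rightarrow> (nat list \<Rightarrow> complex) \<Rightarrow> ctensor" where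
  "mk_tensor ds f = Abs_ctensor (ds, \<lambda>is. if is \<in> multi_indices ds then f is else 0)"

abbreviation order :: "ctensor \<Rightarrow> nat" where
  "order A \<equiv> length (dims A)"

(* The last N modes of A are contracted with the first N modes of B.  The product is only
   meaningful if those modes have the same dimensions. *)
definition einstein_prod :: "ctensor \<Rightarrow> nat \<Rightarrow> ctensor \<Rightarrow> ctensor"
    ("(_ \<star>\<^bsub>_\<^esub>/ _)" [70, 0, 71] 70) where
  "A \<star>\<^bsub>N\<^esub> B =
     (let M = order A - N in
        mk_tensor (take M (dims A) @ drop N (dims B))
          (\<lambda>ix. \<Sum>js \<in> multi_indices (take N (dims B)).
             entry A (take M ix @ js) * entry B (js @ drop M ix)))"

(* The conjugate transpose depends on how the modes are split into two groups: here the first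
   M modes are exchanged with the remaining ones. *)
definition conj_transpose :: "nat \<Rightarrow> ctensor \<Rightarrow> ctensor" where
  "conj_transpose M A =
     (let N = order A - M in
        mk_tensor (drop M (dims A) @ take M (dims A))
          (\<lambda>ix. cnj (entry A (drop N ix @ take N ix))))"

definition hermitian :: "nat \<Rightarrow> ctensor \<Rightarrow> bool" where
  "hermitian M C \<longleftrightarrow> drop M (dims C) = take M (dims C) \<and> conj_transpose M C = C"

definition is_moore_penrose :: "nat \<Rightarrow> ctensor \<Rightarrow> ctensor \<Rightarrow> bool" where
  "is_moore_penrose M X Y \<longleftrightarrow>
     (let N = order X - M in
        dims Y = drop M (dims X) @ take M (dims X) \<and>
        X \<star>\<^bsub>N\<^esub> Y \<star>\<^bsub>M\<^esub> X = X \<and>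
        Y \<star>\<^bsub>M\<^esub> X \<star>\<^bsub>N\<^esub> Y = Y \<and>
        conj_transpose M (X \<star>\<^bsub>N\<^esub> Y) = X \<star>\<^bsub>N\<^esub> Y \<and>
        conj_transpose N (Y \<star>\<^bsub>M\<^esub> X) = Y \<star>\<^bsub>M\<^esub> X)"

(* As for the conjugate transpose, M is the number of modes in the first group. *)
definition moore_penrose :: "nat \<Rightarrow> ctensor \<Rightarrow> ctensor" where
  "moore_penrose M X = (THE Y. is_moore_penrose M X Y)"

lemma dims_mk_tensor [simp]: "dims (mk_tensor ds f) = ds"
  by (simp add: dims_def mk_tensor_def Abs_ctensor_inverse)

lemma entry_mk_tensor:
  "entry (mk_tensor ds f) is = (if is \<in> multi_indices ds then f is else 0)"
  by (simp add: entry_def mk_tensor_def Abs_ctensor_inverse)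

lemma entry_outside: "is \<notin> multi_indices (dims A) \<Longrightarrow> entry A is = 0"
  using Rep_ctensor[of A] by (simp add: dims_def entry_def)

lemma ctensor_eqI:
  assumes "dims A = dims B" "\<And>is. is \<in> multi_indices (dims A) \<Longrightarrow> entry A is = entry B is"
  shows "A = B"
proof -
  have "entry A = entry B"
    using assms entry_outside by (metis ext)
  with assms(1) have "Rep_ctensor A = Rep_ctensor B"
    by (simp add: dims_def entry_def prod_eq_iff)
  then show ?thesis by (simp add: Rep_ctensor_inject)
qed

lemma length_multi_indices: "is \<in> multi_indices ds \<Longrightarrow> length is = length ds"
  by (simp add: multi_indices_def list_all2_lengthD)

lemma append_in_multi_indices:
  "is \<in> multi_indices Is \<Longrightarrow> js \<in> multi_indices Js \<Longrightarrow> is @ js \<in> multi_indices (Is @ Js)"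
  by (simp add: multi_indices_def list_all2_appendI)

lemma dims_einstein_prod:
  assumes "dims A = Is @ Js" "dims B = Js @ Ks"
  shows "dims (A \<star>\<^bsub>length Js\<^esub> B) = Is @ Ks"
  using assms by (simp add: Let_def einstein_prod_def)

lemma entry_einstein_prod:
  assumes "dims A = Is @ Js" "dims B = Js @ Ks"
    and "is \<in> multi_indices Is" "ks \<in> multi_indices Ks"
  shows "entry (A \<star>\<^bsub>length Js\<^esub> B) (is @ ks) =
           (\<Sum>js \<in> multi_indices Js. entry A (is @ js) * entry B (js @ ks))"
  using assms append_in_multi_indices[OF assms(3,4)] length_multi_indices[OF assms(3)]
  by (simp add: Let_def einstein_prod_def entry_mk_tensor)

lemma dims_conj_transpose:
  assumes "dims A = Is @ Js"
  shows "dims (conj_transpose (length Is) A) = Js @ Is"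
  using assms by (simp add: Let_def conj_transpose_def)

lemma entry_conj_transpose:
  assumes "dims A = Is @ Js" "is \<in> multi_indices Is" "js \<in> multi_indices Js"
  shows "entry (conj_transpose (length Is) A) (js @ is) = cnj (entry A (is @ js))"
  using assms append_in_multi_indices[OF assms(3,2)] length_multi_indices[OF assms(3)]
  by (simp add: Let_def conj_transpose_def entry_mk_tensor)

end

theory Submission
  imports Defs
begin

text \<open>
  Grouping the modes turns tensors into matrices, so that the Einstein product and the conjugate
  transpose become multiplication and involution of a semigroup. Put \<open>P = B B\<^sup>\<dagger>\<close>,
  \<open>Q = A\<^sup>\<dagger> A\<close> and \<open>Z = B B\<^sup>H A\<^sup>H\<close>. Condition (i) says
  \<open>Q Z = Z\<close>, which forces \<open>Q\<close> to commute with \<open>B B\<^sup>H\<close> and hence with \<open>P\<close>; all Penrose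
  equations for \<open>B\<^sup>\<dagger> A\<^sup>\<dagger>\<close> but the Hermitian one stated as (ii) follow. Conversely, the reverse
  order law gives \<open>Z = P Q Z\<close>, so \<open>Z\<^sup>H Z = Z\<^sup>H Q Z\<close>, that is, \<open>(Z - Q Z)\<^sup>H (Z - Q Z) = 0\<close>.
  The Moore--Penrose inverse exists because the normal equations of least squares are solvable.
\<close>

section \<open>Penrose equations in involution semigroups\<close>

text \<open>Most of the argument uses only products and adjoints; subtraction and positivity enter
  later, for matrices. Multiplication is total because rectangular matrices will be padded with
  zeros.\<close>

locale star_semigroup =
  fixes mult :: "'a \<Rightarrow> 'a \<Rightarrow> 'a" (infixl "\<cdot>" 70)
    and star :: "'a \<Rightarrow> 'a" ("_\<^sup>H" [1000] 1000)
  assumes assoc: "x \<cdot> y \<cdot> z = x \<cdot> (y \<cdot> z)"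
    and star_mult: "(x \<cdot> y)\<^sup>H = y\<^sup>H \<cdot> x\<^sup>H"
    and star_star [simp]: "x\<^sup>H\<^sup>H = x"
begin

definition penrose :: "'a \<Rightarrow> 'a \<Rightarrow> bool" where
  "penrose x y \<longleftrightarrow> x \<cdot> y \<cdot> x = x \<and> y \<cdot> x \<cdot> y = y \<and> (x \<cdot> y)\<^sup>H = x \<cdot> y \<and> (y \<cdot> x)\<^sup>H = y \<cdot> x"

lemma penroseD:
  assumes "penrose x y"
  shows "x \<cdot> y \<cdot> x = x" "y \<cdot> x \<cdot> y = y" "(x \<cdot> y)\<^sup>H = x \<cdot> y" "(y \<cdot> x)\<^sup>H = y \<cdot> x"
  using assms by (simp_all add: penrose_def)

text \<open>Inserting \<open>x \<cdot> z \<cdot> x\<close> for \<open>x\<close> in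
  \<open>x \<cdot> y\<close> and taking adjoints gives \<open>x \<cdot> y = x \<cdot> z\<close>;
  likewise \<open>y \<cdot> x = z \<cdot> x\<close>. Hence \<open>y\<close>, being
  \<open>y \<cdot> x \<cdot> y\<close>, equals \<open>z \<cdot> x \<cdot> z\<close>.\<close>

lemma penrose_unique:
  assumes y: "penrose x y" and z: "penrose x z"
  shows "y = z"
proof -
  note yD = penroseD[OF y] and zD = penroseD[OF z]
  have "x \<cdot> y = x \<cdot> z \<cdot> (x \<cdot> y)" by (metis zD(1) assoc)
  then have "x \<cdot> y = x \<cdot> y \<cdot> (x \<cdot> z)" by (metis star_mult yD(3) zD(3))
  then have xy: "x \<cdot> y = x \<cdot> z" by (metis assoc yD(1))
  have "y \<cdot> x = y \<cdot> x \<cdot> (z \<cdot> x)" by (metis zD(1) assoc)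
  then have "y \<cdot> x = z \<cdot> x \<cdot> (y \<cdot> x)" by (metis star_mult yD(4) zD(4))
  then have yx: "y \<cdot> x = z \<cdot> x" by (metis assoc yD(1))
  show ?thesis by (metis xy yx assoc yD(2) zD(2))
qed

text \<open>Left multiplication by \<open>g\<^sup>H\<close> gives \<open>(x \<cdot> g)\<^sup>H
  \<cdot> (x \<cdot> g) = (x \<cdot> g)\<^sup>H\<close>, whose left side is self-adjoint. The first
  claim is then the adjoint of the hypothesis.\<close>

lemma normal_equation_inverse:
  assumes "x\<^sup>H \<cdot> x \<cdot> g = x\<^sup>H"
  shows "x \<cdot> g \<cdot> x = x" "(x \<cdot> g)\<^sup>H = x \<cdot> g"
proof -
  have "(x \<cdot> g)\<^sup>H \<cdot> (x \<cdot> g) = (x \<cdot> g)\<^sup>H" by (metis assms assoc star_mult)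
  then show *: "(x \<cdot> g)\<^sup>H = x \<cdot> g" by (metis star_mult star_star)
  have "(x\<^sup>H \<cdot> (x \<cdot> g))\<^sup>H = x" using assms by (simp add: assoc)
  then show "x \<cdot> g \<cdot> x = x" by (simp only: star_mult[of "x\<^sup>H"] * star_star)
qed

text \<open>Here \<open>g\<close> is a {1,3}-inverse and \<open>h\<^sup>H\<close> a {1,4}-inverse of
  \<open>x\<close>; the witness is Urquhart's formula.\<close>

lemma penrose_of_normal_equations:
  assumes g: "x\<^sup>H \<cdot> x \<cdot> g = x\<^sup>H" and h: "x \<cdot> x\<^sup>H \<cdot> h = x"
  shows "penrose x (h\<^sup>H \<cdot> x \<cdot> g)"
proof -
  note g' = normal_equation_inverse[OF g]
  have h': "x\<^sup>H \<cdot> h \<cdot> x\<^sup>H = x\<^sup>H" "(x\<^sup>H \<cdot> h)\<^sup>H = x\<^sup>H \<cdot> h"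
    using normal_equation_inverse[of "x\<^sup>H" h] h by simp_all
  have 1: "x \<cdot> h\<^sup>H \<cdot> x = x" by (metis h'(1) star_mult star_star assoc)
  have 2: "(h\<^sup>H \<cdot> x)\<^sup>H = h\<^sup>H \<cdot> x" by (metis h'(2) star_mult star_star)
  have xy: "x \<cdot> (h\<^sup>H \<cdot> x \<cdot> g) = x \<cdot> g" by (metis 1 assoc)
  have yx: "h\<^sup>H \<cdot> x \<cdot> g \<cdot> x = h\<^sup>H \<cdot> x" by (metis g'(1) assoc)
  have yxy: "h\<^sup>H \<cdot> x \<cdot> (h\<^sup>H \<cdot> x \<cdot> g) = h\<^sup>H \<cdot> x \<cdot> g" by (metis 1 assoc)
  show ?thesis
    by (simp only: penrose_def xy yx yxy g' 2 simp_thms)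
qed

text \<open>In \<open>y \<cdot> x \<cdot> y\<close> one of the two projections is replaced by its
  adjoint. This later confines the support of \<open>y\<close> to that of
  \<open>x\<^sup>H\<close>.\<close>

lemma penrose_factor:
  assumes "penrose x y"
  shows "y = x\<^sup>H \<cdot> (y\<^sup>H \<cdot> y)" "y = y \<cdot> y\<^sup>H \<cdot> x\<^sup>H"
  by (metis penroseD[OF assms] star_mult assoc)+

lemma penrose_star_factor:
  assumes "penrose x y"
  shows "y \<cdot> x \<cdot> x\<^sup>H = x\<^sup>H"
  by (metis penroseD[OF assms] star_mult assoc)

lemma reverse_order_penrose:
  assumes a: "penrose a a'" and b: "penrose b b'"
    and range: "a' \<cdot> a \<cdot> b \<cdot> b\<^sup>H \<cdot> a\<^sup>H = b \<cdot> b\<^sup>H \<cdot> a\<^sup>H"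
    and herm: "(a \<cdot> b \<cdot> b' \<cdot> a')\<^sup>H = a \<cdot> b \<cdot> b' \<cdot> a'"
  shows "penrose (a \<cdot> b) (b' \<cdot> a')"
proof -
  note aD = penroseD[OF a] and bD = penroseD[OF b]
  define p q h k where "p = b \<cdot> b'" "q = a' \<cdot> a" "h = b \<cdot> b\<^sup>H" "k = b'\<^sup>H \<cdot> b'"
  note defs = p_q_h_k_def
  have star: "p\<^sup>H = p" "q\<^sup>H = q" "h\<^sup>H = h"
    using aD bD by (simp_all add: defs star_mult)
  have q: "a\<^sup>H \<cdot> a'\<^sup>H = q" by (metis aD(4) star_mult defs(2))
  have "q \<cdot> h \<cdot> a\<^sup>H = h \<cdot> a\<^sup>H" using range by (simp add: defs assoc)
  \<comment> \<open>Right multiplication by \<open>a'\<^sup>H\<close> turns \<open>a\<^sup>H\<close>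
    into \<open>q\<close>. As \<open>q \<cdot> h \<cdot> q\<close> is self-adjoint, so is
    \<open>h \<cdot> q\<close>, which means that \<open>q\<close> and \<open>h\<close>
    commute.\<close>
  then have "q \<cdot> h \<cdot> q = h \<cdot> q" by (metis q assoc)
  moreover from this have "q \<cdot> h \<cdot> q = q \<cdot> h" by (metis star star_mult assoc)
  ultimately have qh: "q \<cdot> h = h \<cdot> q" by simp
  have pb: "p \<cdot> b = b" using bD by (simp add: defs)
  have ph: "p \<cdot> h = h" by (metis pb defs(3) assoc)
  \<comment> \<open>This factorisation carries commutation from \<open>h\<close> to
    \<open>p\<close>: \<open>q \<cdot> p = h \<cdot> q \<cdot> k\<close> is fixed by left
    multiplication with \<open>p\<close>, and adjoints finish as before.\<close>
  have pk: "p = h \<cdot> k" by (metis bD(1,4) star_mult assoc defs(1,3,4))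
  have "p \<cdot> (q \<cdot> p) = q \<cdot> p" by (metis pk ph qh assoc)
  moreover from this have "p \<cdot> (q \<cdot> p) = p \<cdot> q" by (metis star star_mult assoc)
  ultimately have pq: "p \<cdot> q = q \<cdot> p" by simp
  have aq: "a \<cdot> q = a" "q \<cdot> a' = a'" using aD by (simp_all add: defs assoc)
  have b'p: "b' \<cdot> p = b'" using bD by (simp add: defs assoc)
  have 1: "a \<cdot> b \<cdot> (b' \<cdot> a') \<cdot> (a \<cdot> b) = a \<cdot> b"
  proof -
    have "a \<cdot> b \<cdot> (b' \<cdot> a') \<cdot> (a \<cdot> b) = a \<cdot> (p \<cdot> q) \<cdot> b" by (simp add: defs assoc)
    also have "\<dots> = a \<cdot> q \<cdot> (p \<cdot> b)" by (simp only: pq assoc)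
    finally show ?thesis by (simp only: aq pb)
  qed
  have 2: "b' \<cdot> a' \<cdot> (a \<cdot> b) \<cdot> (b' \<cdot> a') = b' \<cdot> a'"
  proof -
    have "b' \<cdot> a' \<cdot> (a \<cdot> b) \<cdot> (b' \<cdot> a') = b' \<cdot> (q \<cdot> p) \<cdot> a'" by (simp add: defs assoc)
    also have "\<dots> = b' \<cdot> p \<cdot> (q \<cdot> a')" by (simp only: pq[symmetric] assoc)
    finally show ?thesis by (simp only: aq b'p)
  qed
  have 3: "(a \<cdot> b \<cdot> (b' \<cdot> a'))\<^sup>H = a \<cdot> b \<cdot> (b' \<cdot> a')"
    using herm by (simp add: assoc)
  have 4: "(b' \<cdot> a' \<cdot> (a \<cdot> b))\<^sup>H = b' \<cdot> a' \<cdot> (a \<cdot> b)"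
  proof -
    \<comment> \<open>Expanding the last \<open>b\<close> makes a factor \<open>h\<close> appear;
      moving it past \<open>q\<close> lets \<open>b'\<close> absorb it and exhibits the product as
      its own adjoint.\<close>
    have "b' \<cdot> a' \<cdot> (a \<cdot> b) = b' \<cdot> q \<cdot> (b \<cdot> (b' \<cdot> b))" using bD(1) by (simp add: defs assoc)
    also have "b \<cdot> (b' \<cdot> b) = h \<cdot> b'\<^sup>H" by (metis bD(4) star_mult assoc defs(3))
    also have "b' \<cdot> q \<cdot> (h \<cdot> b'\<^sup>H) = b' \<cdot> h \<cdot> q \<cdot> b'\<^sup>H" by (metis qh assoc)
    also have "b' \<cdot> h = b\<^sup>H" using penrose_star_factor[OF b] by (simp add: defs assoc)
    also have "b\<^sup>H \<cdot> q \<cdot> b'\<^sup>H = (b' \<cdot> q \<cdot> b)\<^sup>H" using star by (simp add: star_mult assoc)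
    also have "b' \<cdot> q \<cdot> b = b' \<cdot> a' \<cdot> (a \<cdot> b)" by (simp add: defs assoc)
    finally show ?thesis by simp
  qed
  from 1 2 3 4 show ?thesis by (simp only: penrose_def simp_thms)
qed

text \<open>These are the terms of \<open>(z - w)\<^sup>H (z - w)\<close>, stated separately because
  a semigroup has no subtraction. Their equality will give \<open>w = z\<close> for
  matrices.\<close>

lemma reverse_order_products:
  assumes a: "penrose a a'" and b: "penrose b b'" and ab: "penrose (a \<cdot> b) (b' \<cdot> a')"
  defines "z \<equiv> b \<cdot> b\<^sup>H \<cdot> a\<^sup>H" and "w \<equiv> a' \<cdot> a \<cdot> b \<cdot> b\<^sup>H \<cdot> a\<^sup>H"
  shows "z\<^sup>H \<cdot> w = z\<^sup>H \<cdot> z" "w\<^sup>H \<cdot> z = z\<^sup>H \<cdot> z" "w\<^sup>H \<cdot> w = z\<^sup>H \<cdot> z"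
proof -
  note aD = penroseD[OF a] and bD = penroseD[OF b]
  define p q where "p = b \<cdot> b'" "q = a' \<cdot> a"
  note defs = p_q_def
  have star: "p\<^sup>H = p" "q\<^sup>H = q" using aD bD by (simp_all add: defs)
  have qq: "q \<cdot> q = q" using aD by (simp add: defs assoc)
  have w: "w = q \<cdot> z" by (simp add: w_def z_def defs assoc)
  \<comment> \<open>Since \<open>z = b \<cdot> (a \<cdot> b)\<^sup>H\<close>, the identity
    \<open>y \<cdot> x \<cdot> x\<^sup>H = x\<^sup>H\<close> for \<open>x = a \<cdot> b\<close>
    shows that \<open>z\<close> is fixed by \<open>p \<cdot> q\<close>.\<close>
  have "b \<cdot> ((b' \<cdot> a') \<cdot> (a \<cdot> b) \<cdot> (a \<cdot> b)\<^sup>H) = b \<cdot> (a \<cdot> b)\<^sup>H"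
    by (simp only: penrose_star_factor[OF ab])
  then have z: "p \<cdot> (q \<cdot> z) = z" by (simp add: z_def defs star_mult assoc)
  have "p \<cdot> z = z" using bD(1) by (metis z_def defs(1) assoc)
  then have "z\<^sup>H \<cdot> p = z\<^sup>H" by (metis star(1) star_mult)
  with z have *: "z\<^sup>H \<cdot> (q \<cdot> z) = z\<^sup>H \<cdot> z" by (metis assoc)
  show "z\<^sup>H \<cdot> w = z\<^sup>H \<cdot> z" using * by (simp only: w)
  show "w\<^sup>H \<cdot> z = z\<^sup>H \<cdot> z" using * star by (simp add: w star_mult assoc)
  show "w\<^sup>H \<cdot> w = z\<^sup>H \<cdot> z" using * star qq by (metis w star_mult assoc)
qed

end

section \<open>Matrices over a finite index set\<close>

text \<open>One contraction set \<open>U\<close> serves all products, so matrices of different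
  formats live in a single semigroup.\<close>

definition mat_mult :: "'a set \<Rightarrow> ('a \<Rightarrow> 'a \<Rightarrow> complex) \<Rightarrow> ('a \<Rightarrow> 'a \<Rightarrow> complex) \<Rightarrow> 'a \<Rightarrow> 'a \<Rightarrow> complex"
  where "mat_mult U x y = (\<lambda>i k. \<Sum>j\<in>U. x i j * y j k)"

definition mat_star :: "('a \<Rightarrow> 'a \<Rightarrow> complex) \<Rightarrow> 'a \<Rightarrow> 'a \<Rightarrow> complex"
  where "mat_star x = (\<lambda>i j. cnj (x j i))"

text \<open>Recovers the format of a rectangular matrix from its zero padding.\<close>

definition supported :: "'a set \<Rightarrow> 'b set \<Rightarrow> ('a \<Rightarrow> 'b \<Rightarrow> complex) \<Rightarrow> bool"
  where "supported I J x \<longleftrightarrow> (\<forall>i j. x i j \<noteq> 0 \<longrightarrow> i \<in> I \<and> j \<in> J)"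

interpretation matrix: star_semigroup "mat_mult U" mat_star for U
proof
  fix x y z :: "'a \<Rightarrow> 'a \<Rightarrow> complex"
  show "mat_mult U (mat_mult U x y) z = mat_mult U x (mat_mult U y z)"
  proof (intro ext)
    fix i l
    have "(\<Sum>k\<in>U. (\<Sum>j\<in>U. x i j * y j k) * z k l) = (\<Sum>k\<in>U. \<Sum>j\<in>U. x i j * (y j k * z k l))"
      by (simp add: sum_distrib_right mult.assoc)
    also have "\<dots> = (\<Sum>j\<in>U. x i j * (\<Sum>k\<in>U. y j k * z k l))"
      by (subst sum.swap) (simp add: sum_distrib_left)
    finally show "mat_mult U (mat_mult U x y) z i l = mat_mult U x (mat_mult U y z) i l"
      by (simp add: mat_mult_def)
  qed
  show "mat_star (mat_mult U x y) = mat_mult U (mat_star y) (mat_star x)"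
    by (simp add: mat_mult_def mat_star_def fun_eq_iff mult.commute)
  show "mat_star (mat_star x) = x"
    by (simp add: mat_star_def)
qed

section \<open>Positivity and cancellation\<close>

lemma sum_cnj_mult_self_eq_0:
  fixes w :: "'a \<Rightarrow> complex"
  assumes "finite U" "(\<Sum>i\<in>U. cnj (w i) * w i) = 0" "i \<in> U"
  shows "w i = 0"
proof -
  have "(\<Sum>i\<in>U. cnj (w i) * w i) = of_real (\<Sum>i\<in>U. (cmod (w i))\<^sup>2)"
    by (simp only: of_real_sum complex_norm_square mult.commute)
  with assms(2) have "(\<Sum>i\<in>U. (cmod (w i))\<^sup>2) = 0"
    by (simp only: of_real_eq_0_iff)
  with assms(1,3) show ?thesis
    by (simp add: sum_nonneg_eq_0_iff)
qed

text \<open>The involution is proper: the diagonal of \<open>(y - x)\<^sup>H (y - x)\<close> holds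
  the squared column norms of \<open>y - x\<close> over \<open>U\<close>, and the hypotheses make
  them vanish. The supports settle the rows outside \<open>U\<close>.\<close>

lemma mat_mult_proper:
  assumes "finite U" "supported U U x" "supported U U y"
    and "mat_mult U (mat_star x) y = mat_mult U (mat_star x) x"
    and "mat_mult U (mat_star y) x = mat_mult U (mat_star x) x"
    and "mat_mult U (mat_star y) y = mat_mult U (mat_star x) x"
  shows "y = x"
proof (intro ext)
  fix i j
  have "(\<Sum>i\<in>U. cnj (y i j - x i j) * (y i j - x i j)) =
      mat_mult U (mat_star y) y j j - mat_mult U (mat_star y) x j j
      - mat_mult U (mat_star x) y j j + mat_mult U (mat_star x) x j j"
    by (simp add: mat_mult_def mat_star_def algebra_simps sum.distrib sum_subtractf)
  also have "\<dots> = 0" using assms by simp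
  finally have "y i j - x i j = 0" if "i \<in> U"
    using sum_cnj_mult_self_eq_0[of U "\<lambda>i. y i j - x i j" i] assms(1) that by simp
  with assms(2,3) show "y i j = x i j"
    unfolding supported_def by (metis eq_iff_diff_eq_0)
qed

section \<open>Solvability of the normal equations\<close>

text \<open>Gram--Schmidt: the new column \<open>m\<close> is replaced by its residual \<open>w\<close> against the previous ones.\<close>

lemma normal_equations_solvable:
  fixes x :: "'a \<Rightarrow> 'b \<Rightarrow> complex"
  assumes U: "finite U" and "finite J"
  shows "\<exists>c. \<forall>k\<in>J. (\<Sum>i\<in>U. cnj (x i k) * (b i - (\<Sum>j\<in>J. x i j * c j))) = 0"
  using assms(2)
proof (induction J arbitrary: b)
  case empty
  then show ?case by simp
next
  case (insert m J)
  obtain d where d: "\<And>k. k \<in> J \<Longrightarrow> (\<Sum>i\<in>U. cnj (x i k) * (x i m - (\<Sum>j\<in>J. x i j * d j))) = 0"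
    using insert.IH[of "\<lambda>i. x i m"] by blast
  obtain e where e: "\<And>k. k \<in> J \<Longrightarrow> (\<Sum>i\<in>U. cnj (x i k) * (b i - (\<Sum>j\<in>J. x i j * e j))) = 0"
    using insert.IH[of b] by blast
  define w where "w i = x i m - (\<Sum>j\<in>J. x i j * d j)" for i
  define r where "r i = b i - (\<Sum>j\<in>J. x i j * e j)" for i
  define s where "s = (\<Sum>i\<in>U. cnj (w i) * w i)"
  \<comment> \<open>If \<open>s = 0\<close>, division by zero yields \<open>t = 0\<close>; this is
    harmless because \<open>w\<close> then vanishes on \<open>U\<close>.\<close>
  define t where "t = (\<Sum>i\<in>U. cnj (w i) * r i) / s"
  \<comment> \<open>Adding \<open>t * w\<close> to the old approximation of \<open>b\<close> gives
    \<open>x i m\<close> the coefficient \<open>t\<close> and changes each \<open>e j\<close> by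
    \<open>- t * d j\<close>.\<close>
  define c where "c j = (if j = m then t else e j - t * d j)" for j
  have residual: "b i - (\<Sum>j\<in>insert m J. x i j * c j) = r i - t * w i" for i
  proof -
    have "(\<Sum>j\<in>J. x i j * c j) = (\<Sum>j\<in>J. x i j * e j - t * (x i j * d j))"
      using insert.hyps by (intro sum.cong) (auto simp: c_def algebra_simps)
    also have "\<dots> = (\<Sum>j\<in>J. x i j * e j) - t * (\<Sum>j\<in>J. x i j * d j)"
      by (simp add: sum_subtractf sum_distrib_left)
    finally show ?thesis
      using insert.hyps by (simp add: c_def r_def w_def algebra_simps)
  qed
  have old: "(\<Sum>i\<in>U. cnj (x i k) * w i) = 0" "(\<Sum>i\<in>U. cnj (x i k) * r i) = 0" if "k \<in> J" for k
    using d[OF that] e[OF that] by (simp_all add: w_def r_def)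
  \<comment> \<open>Column \<open>m\<close> and \<open>w\<close> differ by a combination of old
    columns, to which \<open>v\<close> is orthogonal.\<close>
  have new: "(\<Sum>i\<in>U. cnj (x i m) * v i) = (\<Sum>i\<in>U. cnj (w i) * v i)"
    if v: "\<And>k. k \<in> J \<Longrightarrow> (\<Sum>i\<in>U. cnj (x i k) * v i) = 0" for v
  proof -
    have "(\<Sum>i\<in>U. (\<Sum>j\<in>J. cnj (x i j) * cnj (d j)) * v i)
        = (\<Sum>j\<in>J. cnj (d j) * (\<Sum>i\<in>U. cnj (x i j) * v i))"
      unfolding sum_distrib_left sum_distrib_right
      by (subst sum.swap) (simp add: mult_ac)
    also have "\<dots> = 0" by (simp add: v)
    finally show ?thesis
      by (simp add: w_def algebra_simps sum_subtractf sum_distrib_right)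
  qed
  have ts: "t * s = (\<Sum>i\<in>U. cnj (w i) * r i)"
  proof (cases "s = 0")
    case True
    then have "w i = 0" if "i \<in> U" for i
      using sum_cnj_mult_self_eq_0[OF U _ that, of w] by (simp add: s_def)
    with True show ?thesis by simp
  qed (simp add: t_def)
  have split: "(\<Sum>i\<in>U. cnj (x i k) * (r i - t * w i))
      = (\<Sum>i\<in>U. cnj (x i k) * r i) - t * (\<Sum>i\<in>U. cnj (x i k) * w i)" for k
    by (simp add: algebra_simps sum_subtractf sum_distrib_left)
  have "(\<Sum>i\<in>U. cnj (x i k) * (r i - t * w i)) = 0" if "k \<in> insert m J" for k
  proof (cases "k \<in> J")
    case True
    then show ?thesis by (simp add: split old)
  next
    case False
    with that have k: "k = m" by simp
    show ?thesis
      using ts by (simp add: split k new[OF old(1)] new[OF old(2)] s_def)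
  qed
  then show ?case by (intro exI[of _ c]) (simp add: residual)
qed

lemma normal_equation_matrix:
  assumes U: "finite U" and x: "supported U U x"
  shows "\<exists>g. mat_mult U (mat_mult U (mat_star x) x) g = mat_star x"
proof -
  have "\<exists>c. \<forall>k\<in>U. (\<Sum>i\<in>U. cnj (x i k) * (of_bool (i = l) - (\<Sum>j\<in>U. x i j * c j))) = 0" for l
    using normal_equations_solvable[OF U U, of x "\<lambda>i. of_bool (i = l)"] .
  from choice[OF allI, OF this] obtain c where c: "\<forall>l. \<forall>k\<in>U.
      (\<Sum>i\<in>U. cnj (x i k) * (of_bool (i = l) - (\<Sum>j\<in>U. x i j * c l j))) = 0" ..
  \<comment> \<open>Column \<open>l\<close> solves the least squares problem for the
    \<open>l\<close>-th unit vector. Outside \<open>U\<close> it is set to zero, matching the zero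
    columns of \<open>mat_star x\<close>.\<close>
  define g where "g j l = of_bool (l \<in> U) * c l j" for j l
  have "mat_mult U (mat_star x) (mat_mult U x g) k l = mat_star x k l" for k l
  proof (cases "k \<in> U \<and> l \<in> U")
    case True
    then have "(\<Sum>i\<in>U. cnj (x i k) * of_bool (i = l)) = cnj (x l k)"
      using U by (simp add: of_bool_def if_distrib cong: if_cong)
    with spec[OF c, of l] True show ?thesis
      by (simp add: mat_mult_def mat_star_def g_def right_diff_distrib sum_subtractf)
  next
    case False
    with x have "x l k = 0" "k \<notin> U \<Longrightarrow> x i k = 0" for i
      by (auto simp: supported_def)
    with False show ?thesis
      by (auto simp: mat_mult_def mat_star_def g_def)
  qed
  then show ?thesis by (metis ext matrix.assoc)
qed

section \<open>Supports and Moore-Penrose inverses of matrices\<close>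

lemma supported_UNIV: "supported UNIV UNIV x"
  by (simp add: supported_def)

lemma supported_mono: "supported I J x \<Longrightarrow> I \<subseteq> I' \<Longrightarrow> J \<subseteq> J' \<Longrightarrow> supported I' J' x"
  by (auto simp: supported_def)

lemma supported_mat_star: "supported I J x \<Longrightarrow> supported J I (mat_star x)"
  by (simp add: supported_def mat_star_def)

lemma supported_mat_mult:
  assumes "supported I J x" "supported J' K y"
  shows "supported I K (mat_mult U x y)"
proof -
  have "\<exists>j\<in>U. x i j * y j k \<noteq> 0" if "mat_mult U x y i k \<noteq> 0" for i k
    using that by (rule contrapos_np) (auto simp: mat_mult_def intro!: sum.neutral)
  with assms show ?thesis by (fastforce simp: supported_def)
qed

lemma penrose_matrix_exists:
  assumes U: "finite U" "I \<subseteq> U" "J \<subseteq> U" and x: "supported I J x"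
  shows "\<exists>y. supported J I y \<and> matrix.penrose U x y"
proof -
  have xU: "supported U U x" using supported_mono[OF x U(2,3)] .
  obtain g where g: "mat_mult U (mat_mult U (mat_star x) x) g = mat_star x"
    using normal_equation_matrix[OF U(1) xU] by blast
  obtain h where h: "mat_mult U (mat_mult U x (mat_star x)) h = x"
    using normal_equation_matrix[OF U(1) supported_mat_star[OF xU]] by auto
  obtain y where y: "matrix.penrose U x y"
    using matrix.penrose_of_normal_equations[OF g h] by blast
  \<comment> \<open>A left factor \<open>mat_star x\<close> confines the rows of \<open>y\<close>, a
    right one its columns.\<close>
  have "supported J UNIV y" "supported UNIV I y"
    using matrix.penrose_factor[OF y] supported_mat_mult[OF supported_mat_star[OF x] supported_UNIV]
      supported_mat_mult[OF supported_UNIV supported_mat_star[OF x]] by metis+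
  with y show ?thesis by (auto simp: supported_def)
qed

section \<open>Tensors as matrices\<close>

text \<open>\<open>dims A\<close> does not record how the modes split into rows and columns, so the
  split is named explicitly.\<close>

definition shape :: "ctensor \<Rightarrow> nat list \<Rightarrow> nat list \<Rightarrow> bool" where
  "shape A Is Js \<longleftrightarrow> dims A = Is @ Js"

text \<open>The matricisation of a tensor, indexed by the multi-indices themselves instead of by
  flattened numbers.\<close>

definition unfolding_mat :: "nat list \<Rightarrow> nat list \<Rightarrow> ctensor \<Rightarrow> nat list \<Rightarrow> nat list \<Rightarrow> complex" where
  "unfolding_mat Is Js A =
     (\<lambda>i j. if i \<in> multi_indices Is \<and> j \<in> multi_indices Js then entry A (i @ j) else 0)"

lemma finite_multi_indices: "finite (multi_indices ds)"
proof (rule finite_subset)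
  show "multi_indices ds \<subseteq> {xs. set xs \<subseteq> {..<Max (set ds)} \<and> length xs = length ds}"
  proof
    fix xs assume "xs \<in> multi_indices ds"
    then have l: "length xs = length ds" and n: "\<And>i. i < length ds \<Longrightarrow> xs ! i < ds ! i"
      by (auto simp: multi_indices_def list_all2_conv_all_nth)
    have "ds ! i \<le> Max (set ds)" if "i < length ds" for i using that by simp
    with l n have "set xs \<subseteq> {..<Max (set ds)}"
      by (force simp: in_set_conv_nth)
    with l show "xs \<in> {xs. set xs \<subseteq> {..<Max (set ds)} \<and> length xs = length ds}" by simp
  qed
qed (simp add: finite_lists_length_eq)

lemma multi_indices_appendE:
  assumes "ix \<in> multi_indices (Is @ Js)"
  obtains i j where "ix = i @ j" "i \<in> multi_indices Is" "j \<in> multi_indices Js"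
  using assms by (auto simp: multi_indices_def list_all2_append2)

lemma shape_einstein_prod:
  "shape A Is Js \<Longrightarrow> shape B Js Ks \<Longrightarrow> shape (A \<star>\<^bsub>length Js\<^esub> B) Is Ks"
  by (simp add: shape_def dims_einstein_prod)

lemma shape_conj_transpose:
  "shape A Is Js \<Longrightarrow> shape (conj_transpose (length Is) A) Js Is"
  by (simp add: shape_def dims_conj_transpose)

lemma supported_unfolding_mat:
  "supported (multi_indices Is) (multi_indices Js) (unfolding_mat Is Js A)"
  by (simp add: supported_def unfolding_mat_def)

lemma unfolding_mat_einstein_prod:
  assumes "finite U" "multi_indices Js \<subseteq> U" "shape A Is Js" "shape B Js Ks"
  shows "unfolding_mat Is Ks (A \<star>\<^bsub>length Js\<^esub> B)
      = mat_mult U (unfolding_mat Is Js A) (unfolding_mat Js Ks B)"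
proof (intro ext)
  fix i k
  have "mat_mult U (unfolding_mat Is Js A) (unfolding_mat Js Ks B) i k
      = (\<Sum>j\<in>multi_indices Js. unfolding_mat Is Js A i j * unfolding_mat Js Ks B j k)"
    unfolding mat_mult_def
    \<comment> \<open>Indices of \<open>U\<close> outside \<open>multi_indices Js\<close> contribute
      nothing, thanks to the zero padding.\<close>
    by (rule sum.mono_neutral_right[OF assms(1,2)]) (simp add: unfolding_mat_def)
  then show "unfolding_mat Is Ks (A \<star>\<^bsub>length Js\<^esub> B) i k
      = mat_mult U (unfolding_mat Is Js A) (unfolding_mat Js Ks B) i k"
    using assms(3,4) by (auto simp: unfolding_mat_def shape_def entry_einstein_prod)
qed

lemma unfolding_mat_conj_transpose:
  assumes "shape A Is Js"
  shows "unfolding_mat Js Is (conj_transpose (length Is) A) = mat_star (unfolding_mat Is Js A)"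
  using assms
  by (auto simp: unfolding_mat_def mat_star_def shape_def entry_conj_transpose fun_eq_iff)

lemma unfolding_mat_eq_iff:
  assumes "shape A Is Js" "shape B Is Js"
  shows "A = B \<longleftrightarrow> unfolding_mat Is Js A = unfolding_mat Is Js B"
proof
  assume eq: "unfolding_mat Is Js A = unfolding_mat Is Js B"
  show "A = B"
  proof (rule ctensor_eqI)
    show "dims A = dims B" using assms by (simp add: shape_def)
    fix ix assume "ix \<in> multi_indices (dims A)"
    then obtain i j where "ix = i @ j" "i \<in> multi_indices Is" "j \<in> multi_indices Js"
      using assms(1) by (auto simp: shape_def elim: multi_indices_appendE)
    with fun_cong[OF fun_cong[OF eq], of i j] show "entry A ix = entry B ix"
      by (simp add: unfolding_mat_def)
  qed
qed simp

text \<open>Turns the matrix inverse back into a tensor, which gives existence in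
  \<open>ex1_moore_penrose\<close>.\<close>

lemma unfolding_mat_surj:
  assumes "supported (multi_indices Is) (multi_indices Js) y"
  obtains Y where "shape Y Is Js" "unfolding_mat Is Js Y = y"
proof
  let ?Y = "mk_tensor (Is @ Js) (\<lambda>ix. y (take (length Is) ix) (drop (length Is) ix))"
  show "shape ?Y Is Js" by (simp add: shape_def)
  show "unfolding_mat Is Js ?Y = y"
    using assms
    by (auto simp: unfolding_mat_def entry_mk_tensor supported_def fun_eq_iff
        append_in_multi_indices length_multi_indices)
qed

section \<open>Moore-Penrose inverses of tensors\<close>

lemma is_moore_penrose_iff_penrose:
  assumes "finite U" "multi_indices Is \<subseteq> U" "multi_indices Js \<subseteq> U"
    and "shape X Is Js" "shape Y Js Is"
  shows "is_moore_penrose (length Is) X Y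
    \<longleftrightarrow> matrix.penrose U (unfolding_mat Is Js X) (unfolding_mat Js Is Y)"
proof -
  have d: "dims X = Is @ Js" "dims Y = Js @ Is" using assms by (simp_all add: shape_def)
  note [simp] = assms shape_einstein_prod shape_conj_transpose
    unfolding_mat_einstein_prod[of U] unfolding_mat_conj_transpose
  show ?thesis
    \<comment> \<open>The four Penrose equations relate tensors of four different shapes, each
      compared through its own unfolding.\<close>
    by (simp add: is_moore_penrose_def Let_def matrix.penrose_def d
        unfolding_mat_eq_iff[of _ Is Js] unfolding_mat_eq_iff[of _ Js Is]
        unfolding_mat_eq_iff[of _ Is Is] unfolding_mat_eq_iff[of _ Js Js])
qed

lemma is_moore_penrose_shape:
  "shape X Is Js \<Longrightarrow> is_moore_penrose (length Is) X Y \<Longrightarrow> shape Y Js Is"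
  by (simp add: shape_def is_moore_penrose_def Let_def)

lemma ex1_moore_penrose:
  assumes X: "shape X Is Js"
  shows "\<exists>!Y. is_moore_penrose (length Is) X Y"
proof -
  let ?U = "multi_indices Is \<union> multi_indices Js"
  have U: "finite ?U" "multi_indices Is \<subseteq> ?U" "multi_indices Js \<subseteq> ?U"
    by (simp_all add: finite_multi_indices)
  note iff = is_moore_penrose_iff_penrose[OF U X]
  obtain y where y: "supported (multi_indices Js) (multi_indices Is) y"
      "matrix.penrose ?U (unfolding_mat Is Js X) y"
    using penrose_matrix_exists[OF U supported_unfolding_mat] by blast
  obtain Y where "shape Y Js Is" "unfolding_mat Js Is Y = y"
    using unfolding_mat_surj[OF y(1)] .
  with y iff have "is_moore_penrose (length Is) X Y" by simp
  moreover have "Y = Z" if "is_moore_penrose (length Is) X Y" "is_moore_penrose (length Is) X Z" for Y Z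
    using that is_moore_penrose_shape[OF X] iff matrix.penrose_unique
    by (metis unfolding_mat_eq_iff)
  ultimately show ?thesis by blast
qed

text \<open>Unique existence lets the definite description be traded for the Penrose
  equations.\<close>

lemma moore_penrose_eq_iff:
  assumes "shape X Is Js"
  shows "moore_penrose (length Is) X = Y \<longleftrightarrow> is_moore_penrose (length Is) X Y"
  unfolding moore_penrose_def using ex1_moore_penrose[OF assms] by (metis theI')

section \<open>The reverse order law for tensors\<close>

theorem theorem3p6:
  fixes A B :: ctensor and Is Js Ks :: "nat list" and M N L :: nat
  assumes "length Is = M" "length Js = N" "length Ks = L"
    and "dims A = Is @ Js"
    and "dims B = Js @ Ks"
  shows "moore_penrose M (A \<star>\<^bsub>N\<^esub> B) = moore_penrose N B \<star>\<^bsub>N\<^esub> moore_penrose M A \<longleftrightarrow>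
    moore_penrose M A \<star>\<^bsub>M\<^esub> A \<star>\<^bsub>N\<^esub> B \<star>\<^bsub>L\<^esub> conj_transpose N B \<star>\<^bsub>N\<^esub> conj_transpose M A
      = B \<star>\<^bsub>L\<^esub> conj_transpose N B \<star>\<^bsub>N\<^esub> conj_transpose M A
    \<and> hermitian M (A \<star>\<^bsub>N\<^esub> B \<star>\<^bsub>L\<^esub> moore_penrose N B \<star>\<^bsub>N\<^esub> moore_penrose M A)"
proof -
  \<comment> \<open>Large enough for contractions over any of the three groups of modes.\<close>
  define U where "U = multi_indices Is \<union> multi_indices Js \<union> multi_indices Ks"
  have U [simp]: "finite U" "multi_indices Is \<subseteq> U" "multi_indices Js \<subseteq> U" "multi_indices Ks \<subseteq> U"
    by (auto simp: U_def finite_multi_indices)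
  note len = assms(1-3)[symmetric]
  have sh [simp]: "shape A Is Js" "shape B Js Ks"
    using assms by (simp_all add: shape_def)
  define A' B' where "A' = moore_penrose M A" "B' = moore_penrose N B"
  have mp: "is_moore_penrose (length Is) A A'" "is_moore_penrose (length Js) B B'"
    using moore_penrose_eq_iff[OF sh(1), THEN iffD1, OF refl]
      moore_penrose_eq_iff[OF sh(2), THEN iffD1, OF refl]
    by (simp_all only: A'_B'_def len)
  have sh' [simp]: "shape A' Js Is" "shape B' Ks Js"
    using mp is_moore_penrose_shape sh by blast+
  note [simp] = shape_einstein_prod shape_conj_transpose
    unfolding_mat_einstein_prod[of U] unfolding_mat_conj_transpose
  define a b a' b' where "a = unfolding_mat Is Js A" "b = unfolding_mat Js Ks B"
    "a' = unfolding_mat Js Is A'" "b' = unfolding_mat Ks Js B'"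
  note folds = a_b_a'_b'_def[symmetric]
  let ?z = "mat_mult U (mat_mult U b (mat_star b)) (mat_star a)"
  let ?w = "mat_mult U (mat_mult U (mat_mult U (mat_mult U a' a) b) (mat_star b)) (mat_star a)"
  let ?h = "mat_mult U (mat_mult U (mat_mult U a b) b') a'"
  have pen: "matrix.penrose U a a'" "matrix.penrose U b b'"
    using mp by (simp_all add: a_b_a'_b'_def flip: is_moore_penrose_iff_penrose)
  have 1: "moore_penrose M (A \<star>\<^bsub>N\<^esub> B) = B' \<star>\<^bsub>N\<^esub> A'
      \<longleftrightarrow> matrix.penrose U (mat_mult U a b) (mat_mult U b' a')"
    by (simp add: len moore_penrose_eq_iff[of _ Is Ks]
        is_moore_penrose_iff_penrose[of U Is Ks] folds)
  have 2: "A' \<star>\<^bsub>M\<^esub> A \<star>\<^bsub>N\<^esub> B \<star>\<^bsub>L\<^esub> conj_transpose N B \<star>\<^bsub>N\<^esub> conj_transpose M A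
      = B \<star>\<^bsub>L\<^esub> conj_transpose N B \<star>\<^bsub>N\<^esub> conj_transpose M A \<longleftrightarrow> ?w = ?z"
    by (simp add: len unfolding_mat_eq_iff[of _ Js Is] folds)
  \<comment> \<open>This shape discharges the dimension clause in \<open>hermitian\<close>, leaving
    only the adjoint equation.\<close>
  have "shape (A \<star>\<^bsub>N\<^esub> B \<star>\<^bsub>L\<^esub> B' \<star>\<^bsub>N\<^esub> A') Is Is" by (simp add: len)
  then have "hermitian M (A \<star>\<^bsub>N\<^esub> B \<star>\<^bsub>L\<^esub> B' \<star>\<^bsub>N\<^esub> A')
      \<longleftrightarrow> conj_transpose M (A \<star>\<^bsub>N\<^esub> B \<star>\<^bsub>L\<^esub> B' \<star>\<^bsub>N\<^esub> A') = A \<star>\<^bsub>N\<^esub> B \<star>\<^bsub>L\<^esub> B' \<star>\<^bsub>N\<^esub> A'"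
    by (simp add: hermitian_def shape_def len)
  also have "\<dots> \<longleftrightarrow> mat_star ?h = ?h"
    by (simp add: len unfolding_mat_eq_iff[of _ Is Is] folds)
  finally have 3: "hermitian M (A \<star>\<^bsub>N\<^esub> B \<star>\<^bsub>L\<^esub> B' \<star>\<^bsub>N\<^esub> A') \<longleftrightarrow> mat_star ?h = ?h" .
  \<comment> \<open>The outermost factors of \<open>?w\<close> and \<open>?z\<close> determine their
    supports, as required for \<open>mat_mult_proper\<close>.\<close>
  have "supported U U a'" "supported U U b" "supported U U (mat_star a)"
    unfolding a_b_a'_b'_def
    by (rule supported_mono[OF supported_unfolding_mat U(3,2)]
        supported_mono[OF supported_unfolding_mat U(3,4)]
        supported_mono[OF supported_mat_star[OF supported_unfolding_mat] U(3,2)])+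
  then have sup: "supported U U ?z" "supported U U ?w"
    by (meson supported_mat_mult supported_UNIV)+
  have "matrix.penrose U (mat_mult U a b) (mat_mult U b' a') \<longleftrightarrow> ?w = ?z \<and> mat_star ?h = ?h"
  proof (intro iffI conjI)
    assume ab: "matrix.penrose U (mat_mult U a b) (mat_mult U b' a')"
    show "?w = ?z"
      using mat_mult_proper[OF U(1) sup] matrix.reverse_order_products[OF pen ab] by blast
    show "mat_star ?h = ?h"
      using matrix.penroseD(3)[OF ab] by (simp only: matrix.assoc)
  next
    assume "?w = ?z \<and> mat_star ?h = ?h"
    then show "matrix.penrose U (mat_mult U a b) (mat_mult U b' a')"
      using matrix.reverse_order_penrose[OF pen] by blast
  qed
  with 1 2 3 show ?thesis by (simp only: A'_B'_def)
qed

end
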